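(* Let $n \ge k \ge 3$ be positive integers, and consider a stick of length $n$, viewed as the interval $[0,n]$. Pick $k-1$ distinct interior integer points on the stick, independently and at random (that is, a uniformly random $(k-1)$-element subset of $\{1,2,\ldots,n-1\}$), and cut the stick at these $k-1$ points. The probability that the resulting $k$ pieces form a $k$-gon is $$1 - \frac{k\binom{\lfloor n/2 \rfloor}{k-1}}{\binom{n-1}{k-1}}.$$
   Context: If the cut points are $a_1 < a_2 < \cdots < a_{k-1}$, the pieces have lengths $x_1 = a_1$, $x_i = a_i - a_{i-1}$ for $2 \le i \le k-1$, and $x_k = n - a_{k-1}$. Thus the sample space is identified with the set of integer vectors $(x_1,\ldots,x_k)$ with all $x_i \ge 1$ and $\sum_i x_i = n$, all equally likely. The $k$ pieces "form a $k$-gon" if there exists a (convex) nondegenerate planar polygon (i.e., with nonempty interior) with $k$ sides whose multiset of side lengths is $\{x_1,\ldots,x_k\}$. The sides may be arranged in any order. The convention $\binom{m}{j} = 0$ for integers $0 \le m < j$ is used. *)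

theory Defs
  imports "HOL-Probability.Probability"
begin

(* Truncated subtraction is harmless for A \<subseteq> {1..n - 1}: the end points
   0, a_1, ..., a_{k-1}, n are then increasing. *)
definition pieces :: "nat \<Rightarrow> nat set \<Rightarrow> nat list" where
  "pieces n A =
     (let as = sorted_list_of_set A in map2 (\<lambda>a b. b - a) (0 # as) (as @ [n]))"

(* A polygon is the filled region. Its sides are the one-dimensional faces, so consecutive
   sides are never collinear. *)
definition convex_polygon :: "nat \<Rightarrow> (real^2) set \<Rightarrow> bool" where
  "convex_polygon k P \<longleftrightarrow>
     polytope P \<and> interior P \<noteq> {} \<and> card {e. e edge_of P} = k"

(* An edge is a segment, so its diameter is its length. The set of edges of a polytope is
   finite, as mset_set requires. *)
definition side_lengths :: "(real^2) set \<Rightarrow> real multiset" where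
  "side_lengths P = image_mset diameter (mset_set {e. e edge_of P})"

definition forms_polygon :: "nat list \<Rightarrow> bool" where
  "forms_polygon xs \<longleftrightarrow>
     (\<exists>P. convex_polygon (length xs) P \<and> side_lengths P = mset (map real xs))"

end

theory Submission
  imports Defs
begin

text \<open>
  Integer lengths $x_1, \ldots, x_k \geq 1$ with sum $n$ and $k \geq 3$ are the sides of a
  $k$-gon exactly when every $x_i$ is less than $n/2$, that is, less than the sum of the others.

  The condition is necessary: project a polygon orthogonally onto the line of one of its edges.
  The other edges cover this edge in projection, and projecting does not lengthen any of them;
  it shortens those that are not parallel to the chosen edge, and such edges exist
  (\<open>two_diameter_edge_less_perimeter\<close>).

  It is sufficient: a chord of a circle of diameter $s$ that subtends the central angle
  $2\alpha$ has length $s \sin \alpha$. So a polygon inscribed in a circle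
  with the prescribed sides, in any prescribed order, amounts to positive half-angles $\alpha_i$ with sum $\pi$ whose sines
  are proportional to the $x_i$; these come from the intermediate value theorem
  (\<open>exists_half_angles\<close>). Consecutive chords of points on a circle are the edges of
  the convex hull of these points (\<open>edges_of_cyclic_polygon\<close>).

  It remains to count. Cutting is a bijection between the $(k-1)$-subsets of
  $\{1, \ldots, n-1\}$ and the compositions of $n$ into $k$ parts (\<open>bij_betw_pieces\<close>).
  At most one part of a composition into at least three parts can be $\geq n/2$, so the
  compositions that fail the condition split according to the position of that part; removing
  $\lceil n/2 \rceil - 1$ from it leaves a composition of $\lfloor n/2 \rfloor + 1$
  into $k$ parts, and there are $\binom{\lfloor n/2 \rfloor}{k-1}$ of these for each of
  the $k$ positions (\<open>card_compositions_long_part\<close>).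
\<close>

section \<open>An edge is shorter than all other edges together\<close>

lemma edge_of_is_segment:
  fixes P :: "'a::euclidean_space set"
  assumes "polytope P" "e edge_of P"
  obtains a b where "e = closed_segment a b" "a \<noteq> b"
proof -
  have e: "e face_of P" "aff_dim e = 1" using assms(2) by (auto simp: edge_of_def)
  have "e \<noteq> {}" using e(2) by auto
  moreover have "compact e" "convex e"
    using e(1) assms(1) by (auto intro: face_of_imp_compact face_of_imp_convex polytope_imp_compact polytope_imp_convex)
  moreover have "collinear e" using e(2) by (simp add: collinear_aff_dim)
  ultimately obtain a b where "e = closed_segment a b"
    by (metis compact_convex_collinear_segment)
  moreover from this have "a \<noteq> b" using e(2) by auto
  ultimately show thesis by (rule that)
qed

lemma diameter_closed_segment:
  fixes a b :: "'a::euclidean_space"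
  shows "diameter (closed_segment a b) = dist a b"
proof (rule antisym)
  have "dist x y \<le> dist a b" if "x \<in> closed_segment a b" "y \<in> closed_segment a b" for x y
  proof -
    have "dist x y \<le> max (dist x a) (dist x b)"
      using that segment_furthest_le[of y a b x] by (auto simp: dist_norm norm_minus_commute)
    also have "\<dots> \<le> dist a b"
      using that dist_in_closed_segment[of x a b] by (simp add: dist_commute)
    finally show ?thesis .
  qed
  then show "diameter (closed_segment a b) \<le> dist a b"
    by (intro diameter_le) (auto simp: dist_norm)
  show "dist a b \<le> diameter (closed_segment a b)"
    by (rule diameter_bounded_bound) (auto simp: bounded_closed_segment)
qed

lemma measure_inner_image_closed_segment:
  fixes u p q :: "'a::euclidean_space"
  shows "measure lborel ((\<bullet>) u ` closed_segment p q) = \<bar>u \<bullet> (q - p)\<bar>"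
    and "(\<bullet>) u ` closed_segment p q \<in> fmeasurable lborel"
proof -
  have "(\<bullet>) u ` closed_segment p q = closed_segment (u \<bullet> p) (u \<bullet> q)"
    by (rule closed_segment_linear_image[symmetric]) (simp add: bounded_linear.linear bounded_linear_inner_right)
  then show "measure lborel ((\<bullet>) u ` closed_segment p q) = \<bar>u \<bullet> (q - p)\<bar>"
    "(\<bullet>) u ` closed_segment p q \<in> fmeasurable lborel"
    by (auto simp: closed_segment_eq_real_ivl inner_diff_right fmeasurable_def emeasure_lborel_Icc_eq)
qed

text \<open>A linear functional maps relative interiors of convex sets onto relative interiors; where the
  interior is nonempty, it is the relative interior.\<close>
lemma interior_image_inner:
  fixes u :: "'a::euclidean_space"
  assumes "convex P" "interior P \<noteq> {}" 
  shows "interior ((\<bullet>) u ` P) \<subseteq> (\<bullet>) u ` interior P"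
proof -
  have lin: "linear ((\<bullet>) u)" by (simp add: bounded_linear.linear bounded_linear_inner_right)
  have "interior ((\<bullet>) u ` P) \<subseteq> rel_interior ((\<bullet>) u ` P)"
    by (rule interior_subset_rel_interior)
  also have "\<dots> = (\<bullet>) u ` rel_interior P"
    using rel_interior_convex_linear_image[OF lin assms(1)] by simp
  finally show ?thesis using assms(2) by (simp add: rel_interior_nonempty_interior)
qed

text \<open>Let \<open>u\<close> span the edge \<open>e = [a, b]\<close> and let \<open>w\<close> be its outer normal. Above every
  interior point of the projection of \<open>e\<close> to \<open>u\<close> there is an interior point of \<open>P\<close>, and the ray from it
  in direction \<open>- w\<close> leaves \<open>P\<close> through another edge. So the projections of the other edges cover
  that of \<open>e\<close>, and comparing Lebesgue measures bounds \<open>diameter e\<close> by the sum of the other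
  diameters. Equality would need all edges parallel to \<open>e\<close>; then the functional \<open>w\<close> would take only
  finitely many values on the frontier, hence on the interior, since every interior point reaches
  the frontier in direction \<open>u\<close>.\<close>
lemma two_diameter_edge_less_perimeter:
  fixes P :: "(real^2) set"
  assumes poly: "polytope P" and int: "interior P \<noteq> {}" and e: "e edge_of P"
  shows "2 * diameter e < (\<Sum>d | d edge_of P. diameter d)"
proof -
  let ?E = "{d. d edge_of P}"
  have cvx: "convex P" and bdd: "bounded P" and ph: "polyhedron P"
    using poly by (auto simp: polytope_imp_convex polytope_imp_bounded polytope_imp_polyhedron)
  have finE: "finite ?E"
    by (rule finite_subset[OF _ finite_polytope_faces[OF poly]]) (auto simp: edge_of_def)
  have dim: "aff_dim P = 2"
    using aff_dim_nonempty_interior[OF int] by simp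
  have frontier: "frontier P \<subseteq> \<Union>?E"
    using rel_frontier_of_polyhedron[OF ph] rel_frontier_nonempty_interior[OF int] dim
    by (auto simp: facet_of_def edge_of_def)
  obtain w c where wc: "P \<subseteq> {x. w \<bullet> x \<le> c}" "e = P \<inter> {x. w \<bullet> x = c}"
    using e exposed_face_of_polyhedron[OF ph, of e] unfolding edge_of_def exposed_face_of_def by blast
  have w0: "w \<noteq> 0"
  proof
    assume "w = 0"
    moreover have "e \<noteq> {}" using e by (auto simp: edge_of_def)
    ultimately have "e = P" using wc by auto
    then show False using e dim by (simp add: edge_of_def)
  qed
  obtain a b where ab: "e = closed_segment a b" "a \<noteq> b"
    using edge_of_is_segment[OF poly e] .
  define u where "u = b - a"
  have u0: "u \<noteq> 0" using ab by (simp add: u_def)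
  have wab: "w \<bullet> a = c" "w \<bullet> b = c" and abP: "a \<in> P" "b \<in> P"
    using ab wc(2) by auto
  then have uw: "u \<bullet> w = 0" by (simp add: u_def inner_commute[of _ w] inner_diff_right)
  have ray: "\<exists>d\<in>?E. \<exists>t>0. p + t *\<^sub>R v \<in> d" if pv: "p \<in> interior P" "v \<noteq> 0" for p v
  proof -
    obtain t where "0 < t" "p + t *\<^sub>R v \<in> frontier P"
      using ray_to_frontier[OF bdd pv] by blast
    then show ?thesis using frontier by blast
  qed
  have cover: "{u \<bullet> a <..< u \<bullet> b} \<subseteq> (\<Union>d\<in>?E - {e}. (\<bullet>) u ` d)"
  proof
    fix t assume t: "t \<in> {u \<bullet> a <..< u \<bullet> b}"
    have "closed_segment (u \<bullet> a) (u \<bullet> b) = (\<bullet>) u ` closed_segment a b"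
      by (rule closed_segment_linear_image) (simp add: bounded_linear.linear bounded_linear_inner_right)
    also have "\<dots> \<subseteq> (\<bullet>) u ` P" using ab(1) wc(2) by blast
    finally have "{u \<bullet> a <..< u \<bullet> b} \<subseteq> (\<bullet>) u ` P"
      by (auto simp: closed_segment_eq_real_ivl subset_iff split: if_splits)
    then have "{u \<bullet> a <..< u \<bullet> b} \<subseteq> interior ((\<bullet>) u ` P)"
      by (simp add: interior_maximal)
    with t interior_image_inner[OF cvx int] obtain p where p: "p \<in> interior P" "t = u \<bullet> p"
      by blast
    obtain d s where ds: "d \<in> ?E" "s > 0" "p + s *\<^sub>R (- w) \<in> d"
      using ray[OF p(1), of "- w"] w0 by auto
    have "w \<bullet> p \<le> c" using p(1) wc(1) interior_subset by blast
    moreover have "w \<bullet> w > 0" using w0 by simp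
    ultimately have "w \<bullet> (p + s *\<^sub>R (- w)) < c"
      using ds(2) by (smt (verit) inner_add_right inner_minus_right inner_scaleR_right mult_pos_pos scaleR_minus_right)
    then have "p + s *\<^sub>R (- w) \<notin> e" using wc(2) by auto
    then have "d \<noteq> e" using ds(3) by auto
    moreover have "u \<bullet> (p + s *\<^sub>R (- w)) = t"
      using uw p(2) by (simp add: inner_diff_right)
    ultimately show "t \<in> (\<Union>d\<in>?E - {e}. (\<bullet>) u ` d)" using ds by blast
  qed
  have proj_le: "measure lborel ((\<bullet>) u ` d) \<le> norm u * diameter d" and meas: "(\<bullet>) u ` d \<in> fmeasurable lborel"
    if "d \<in> ?E" for d
  proof -
    obtain p q where "d = closed_segment p q" using edge_of_is_segment[OF poly] \<open>d \<in> ?E\<close> by blast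
    then show "measure lborel ((\<bullet>) u ` d) \<le> norm u * diameter d" "(\<bullet>) u ` d \<in> fmeasurable lborel"
      using Cauchy_Schwarz_ineq2[of u "q - p"]
      by (auto simp: measure_inner_image_closed_segment diameter_closed_segment dist_norm norm_minus_commute)
  qed
  \<comment> \<open>Some edge is not parallel to \<open>e\<close>; its projection is strictly shorter.\<close>
  have "\<exists>d\<in>?E. \<exists>p q. p \<in> d \<and> q \<in> d \<and> w \<bullet> p \<noteq> w \<bullet> q"
  proof (rule ccontr)
    assume "\<not> ?thesis"
    then have const: "w \<bullet> p = w \<bullet> q" if "d \<in> ?E" "p \<in> d" "q \<in> d" for d p q using that by blast
    have "(\<bullet>) w ` interior P \<subseteq> (\<lambda>d. w \<bullet> (SOME x. x \<in> d)) ` ?E"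
    proof clarify
      fix p assume "p \<in> interior P"
      then obtain d t where d: "d \<in> ?E" "p + t *\<^sub>R u \<in> d" using ray u0 by blast
      have "w \<bullet> p = w \<bullet> (p + t *\<^sub>R u)" using uw by (simp add: inner_add_right inner_commute)
      also have "\<dots> = w \<bullet> (SOME x. x \<in> d)" using d by (intro const[of d]) (auto intro: someI)
      finally show "w \<bullet> p \<in> (\<lambda>d. w \<bullet> (SOME x. x \<in> d)) ` ?E" using d(1) by auto
    qed
    then have "finite ((\<bullet>) w ` interior P)" using finE finite_surj by blast
    moreover have "open ((\<bullet>) w ` interior P)"
    proof (rule open_surjective_linear_image)
      show "linear ((\<bullet>) w)" by (simp add: bounded_linear.linear bounded_linear_inner_right)
      show "surj ((\<bullet>) w)"
      proof (rule surjI)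
        show "w \<bullet> ((y / (w \<bullet> w)) *\<^sub>R w) = y" for y using w0 by simp
      qed
    qed simp
    ultimately show False using int by (metis finite_imp_not_open image_is_empty)
  qed
  then obtain d p q where d: "d \<in> ?E" "p \<in> d" "q \<in> d" "w \<bullet> p \<noteq> w \<bullet> q" by blast
  then have "d \<noteq> e" using wc(2) by auto
  have proj_less: "measure lborel ((\<bullet>) u ` d) < norm u * diameter d"
  proof -
    obtain p' q' where pq: "d = closed_segment p' q'" using edge_of_is_segment[OF poly] \<open>d \<in> ?E\<close> by blast
    have "\<bar>u \<bullet> (q' - p')\<bar> \<noteq> norm u * norm (q' - p')"
    proof
      assume "\<bar>u \<bullet> (q' - p')\<bar> = norm u * norm (q' - p')"
      then have "collinear {0, u, q' - p'}" by (simp add: norm_cauchy_schwarz_equal)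
      then obtain t where t: "q' - p' = t *\<^sub>R u" using u0 by (auto simp: collinear_lemma)
      have "w \<bullet> x = w \<bullet> p'" if "x \<in> d" for x
      proof -
        obtain s where "x = (1 - s) *\<^sub>R p' + s *\<^sub>R q'"
          using \<open>x \<in> d\<close> pq by (auto simp: in_segment)
        then have "x = p' + s *\<^sub>R (q' - p')" by (simp add: algebra_simps)
        then show ?thesis using t uw by (simp add: inner_add_right inner_commute)
      qed
      then show False using d by metis
    qed
    then show ?thesis using Cauchy_Schwarz_ineq2[of u "q' - p'"]
      by (simp add: pq measure_inner_image_closed_segment diameter_closed_segment dist_norm norm_minus_commute)
  qed
  have "u \<bullet> b - u \<bullet> a = norm u * norm u"
    by (simp add: u_def flip: inner_diff_right power2_norm_eq_inner power2_eq_square)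
  then have "norm u * norm u = measure lborel {u \<bullet> a <..< u \<bullet> b}"
    by (smt (verit) measure_lborel_Ioo norm_ge_zero mult_nonneg_nonneg)
  also have "\<dots> \<le> measure lborel (\<Union>d\<in>?E - {e}. (\<bullet>) u ` d)"
  proof (rule measure_mono_fmeasurable[OF cover])
    show "(\<Union>d\<in>?E - {e}. (\<bullet>) u ` d) \<in> fmeasurable lborel"
      using finE meas by (intro fmeasurable.finite_UN) auto
  qed simp
  also have "\<dots> \<le> (\<Sum>d\<in>?E - {e}. measure lborel ((\<bullet>) u ` d))"
    using finE fmeasurableD[OF meas] by (intro measure_UNION_le) auto
  also have "\<dots> < (\<Sum>d\<in>?E - {e}. norm u * diameter d)"
    using finE proj_le proj_less d(1) \<open>d \<noteq> e\<close> by (intro sum_strict_mono_ex1) auto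
  also have "\<dots> = norm u * (\<Sum>d\<in>?E - {e}. diameter d)" by (simp add: sum_distrib_left)
  finally have "norm u < (\<Sum>d\<in>?E - {e}. diameter d)" using u0 by simp
  moreover have "diameter e = norm u"
    by (simp add: ab(1) diameter_closed_segment dist_norm u_def norm_minus_commute)
  moreover have "(\<Sum>d\<in>?E. diameter d) = diameter e + (\<Sum>d\<in>?E - {e}. diameter d)"
    using finE e by (simp add: sum.remove)
  ultimately show ?thesis by linarith
qed

lemma forms_polygon_imp_short:
  assumes "forms_polygon xs" "x \<in> set xs"
  shows "2 * x < sum_list xs"
proof -
  obtain P where P: "convex_polygon (length xs) P" "side_lengths P = mset (map real xs)"
    using assms(1) by (auto simp: forms_polygon_def)
  have poly: "polytope P" "interior P \<noteq> {}" using P(1) by (auto simp: convex_polygon_def)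
  have fin: "finite {e. e edge_of P}"
    by (rule finite_subset[OF _ finite_polytope_faces[OF poly(1)]]) (auto simp: edge_of_def)
  have "real x \<in># side_lengths P" using assms(2) P(2) by simp
  then obtain e where e: "e edge_of P" "diameter e = real x"
    using fin by (auto simp: side_lengths_def)
  have "(\<Sum>d | d edge_of P. diameter d) = sum_mset (side_lengths P)"
    by (simp add: side_lengths_def sum_unfold_sum_mset)
  also have "\<dots> = real (sum_list xs)"
    by (simp only: P(2) sum_mset_sum_list) (simp add: sum_list_of_nat)
  finally have "2 * real x < real (sum_list xs)"
    using two_diameter_edge_less_perimeter[OF poly e(1)] e(2) by simp
  then show ?thesis by linarith
qed

section \<open>Cyclic polygons with prescribed sides\<close>

text \<open>Prescribe the ratio \<open>t\<close> of the largest side \<open>x m\<close> to the diameter of the circle. The half-angles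
  of the other sides must then be \<open>arcsin (t * x i / x m)\<close>, with sum \<open>A t\<close>, and \<open>pi - A t\<close> is left
  for side \<open>m\<close>. This closes the polygon iff \<open>sin (A t) = t\<close>. The function \<open>sin (A t) - t\<close> vanishes
  at \<open>0\<close> with positive derivative, because \<open>x m\<close> is less than the sum of the other sides, and is
  at most \<open>0\<close> at \<open>t = 1\<close>, or already where \<open>A\<close> reaches \<open>pi\<close>. Giving side \<open>m\<close> the angle
  \<open>pi - A t\<close>, and not an arcsine, treats alike the polygons that contain the centre of
  the circle and those that do not.\<close>
lemma exists_half_angles:
  fixes x :: "'a \<Rightarrow> real"
  assumes fin: "finite I" and pos: "\<And>i. i \<in> I \<Longrightarrow> 0 < x i" and m: "m \<in> I"
    and max: "\<And>i. i \<in> I \<Longrightarrow> x i \<le> x m" and short: "x m < sum x (I - {m})"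
  obtains s \<alpha> where "0 < s" "\<And>i. i \<in> I \<Longrightarrow> 0 < \<alpha> i" "\<And>i. i \<in> I \<Longrightarrow> x i = s * sin (\<alpha> i)"
    "sum \<alpha> I = pi"
proof -
  define J where "J = I - {m}"
  define y where "y i = x i / x m" for i
  have xm: "0 < x m" using pos m by blast
  have "J \<noteq> {}"
  proof
    assume "J = {}"
    with short have "x m < sum x {}" by (simp only: J_def)
    then show False using xm by simp
  qed
  then have J: "finite J" "J \<noteq> {}" using fin by (auto simp: J_def)
  have y: "0 < y i" "y i \<le> 1" if "i \<in> J" for i
    using that pos[of i] max[of i] xm by (auto simp: J_def y_def)
  have ysum: "1 < sum y J"
    using short xm by (simp add: y_def J_def flip: sum_divide_distrib)
  define A where "A t = (\<Sum>i\<in>J. arcsin (t * y i))" for t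
  have ty: "0 < t * y i" "t * y i \<le> 1" if "i \<in> J" "0 < t" "t \<le> 1" for i t
    using that y[of i] mult_mono[of t 1 "y i" 1] by auto
  have ty1: "-1 \<le> t * y i" "t * y i \<le> 1" if "i \<in> J" "0 \<le> t" "t \<le> 1" for i t
    using that y[of i] mult_mono[of t 1 "y i" 1] mult_nonneg_nonneg[of t "y i"] by linarith+
  have contA: "continuous_on {0..1} A"
    unfolding A_def using ty1 by (intro continuous_intros) auto
  have monoA: "A t < A t'" if "0 < t" "t < t'" "t' \<le> 1" for t t'
    unfolding A_def
  proof (rule sum_strict_mono[OF J])
    fix i assume "i \<in> J"
    then show "arcsin (t * y i) < arcsin (t' * y i)"
      using that y[of i] ty1[of i t] ty1[of i t'] by (intro arcsin_less_arcsin) auto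
  qed
  have A0: "A 0 = 0" by (simp add: A_def)
  have Apos: "0 < A t" if "0 < t" "t \<le> 1" for t
    unfolding A_def
  proof (rule sum_pos[OF J])
    fix i assume "i \<in> J"
    then show "0 < arcsin (t * y i)"
      using arcsin_less_arcsin[of 0 "t * y i"] ty[of i t] that by simp
  qed
  obtain t0 where t0: "0 < t0" "t0 \<le> 1" "A t0 \<le> pi" "sin (A t0) \<le> t0"
  proof (cases "A 1 \<le> pi")
    case True
    then show ?thesis using that[of 1] by simp
  next
    case False
    then obtain t where t: "0 \<le> t" "t \<le> 1" "A t = pi"
      using IVT'[of A 0 pi 1] A0 contA by auto
    then have "t \<noteq> 0" using A0 by auto
    then show ?thesis using that[of t] t by simp
  qed
  have "((\<lambda>t. sin (A t) - t) has_real_derivative (sum y J - 1)) (at 0)"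
    unfolding A_def by (auto intro!: derivative_eq_intros)
  from DERIV_pos_inc_right[OF this] ysum
  obtain d where d: "0 < d" "\<And>h. 0 < h \<Longrightarrow> h < d \<Longrightarrow> sin (A 0) - 0 < sin (A (0 + h)) - (0 + h)"
    by auto
  \<comment> \<open>A point with \<open>sin (A t) > t\<close> that lies before \<open>t0\<close>.\<close>
  define t1 where "t1 = min t0 d / 2"
  have t1: "0 < t1" "t1 < t0" "t1 < d" using t0(1) d(1) by (auto simp: t1_def)
  have "t1 < sin (A t1)" using d(2)[of t1] t1 by (simp add: A0)
  moreover have "continuous_on {t1..t0} (\<lambda>t. sin (A t) - t)"
    using t0 t1 by (intro continuous_intros continuous_on_subset[OF contA]) auto
  ultimately obtain t where t: "t1 \<le> t" "t \<le> t0" "sin (A t) = t"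
    using IVT2'[of "\<lambda>t. sin (A t) - t" t0 0 t1] t0 t1 by auto
  have tt: "0 < t" "t \<le> 1" using t t0 t1 by auto
  \<comment> \<open>\<open>A t = pi\<close> is impossible, as it would give \<open>t = sin pi = 0\<close>.\<close>
  have Api: "A t < pi"
  proof (cases "t = t0")
    case True
    then show ?thesis using t0 t tt by (cases "A t0 = pi") auto
  next
    case False
    then show ?thesis using monoA[of t t0] t t0 tt by simp
  qed
  define \<alpha> where "\<alpha> i = (if i = m then pi - A t else arcsin (t * y i))" for i
  have sumJ: "sum \<alpha> J = A t"
    unfolding A_def by (rule sum.cong) (auto simp: J_def \<alpha>_def)
  show thesis
  proof (rule that[of "x m / t" \<alpha>])
    show "0 < x m / t" using xm tt by simp
    show "0 < \<alpha> i" if "i \<in> I" for i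
      using Api arcsin_less_arcsin[of 0 "t * y i"] ty[of i t] that tt
      by (auto simp: \<alpha>_def J_def)
    show "x i = x m / t * sin (\<alpha> i)" if "i \<in> I" for i
    proof (cases "i = m")
      case True
      then show ?thesis using t(3) tt by (simp add: \<alpha>_def)
    next
      case False
      then have "sin (\<alpha> i) = t * y i"
        using ty1[of i t] tt that by (simp add: \<alpha>_def J_def)
      then show ?thesis using xm tt by (simp add: y_def)
    qed
    show "sum \<alpha> I = pi"
      using sumJ m fin by (simp add: J_def sum.remove[of I m] \<alpha>_def)
  qed
qed

definition circ :: "real \<Rightarrow> real^2" where
  "circ t = vector [cos t, sin t]"

lemma inner_circ: "circ s \<bullet> circ t = cos (s - t)"
  by (simp add: circ_def inner_vec_def sum_2 cos_diff)

lemma dist_circ: "dist (circ (2 * s)) (circ (2 * t)) = 2 * \<bar>sin (s - t)\<bar>"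
proof -
  have "(dist (circ (2 * s)) (circ (2 * t)))\<^sup>2 = 2 - 2 * cos (2 * s - 2 * t)"
    by (simp add: dist_norm power2_norm_eq_inner inner_diff_left inner_diff_right inner_circ
        cos_diff algebra_simps)
  also have "cos (2 * s - 2 * t) = 1 - 2 * (sin (s - t))\<^sup>2"
    using cos_double_sin[of "s - t"] by (simp only: right_diff_distrib)
  finally have "(dist (circ (2 * s)) (circ (2 * t)))\<^sup>2 = (2 * \<bar>sin (s - t)\<bar>)\<^sup>2"
    by (simp add: power_mult_distrib)
  then show ?thesis by (rule power2_eq_imp_eq) simp_all
qed

text \<open>The chord of the unit circle between the angles \<open>2 * a\<close> and \<open>2 * b\<close> has normal \<open>circ (a + b)\<close>.
  The product form shows on which side of the chord a third point of the circle lies.\<close>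
lemma circ_chord_side:
  "circ (a + b) \<bullet> circ (2 * t) - cos (b - a) = - 2 * sin (t - a) * sin (t - b)"
proof -
  have "cos (a + b - 2 * t) = cos ((t - a) + (t - b))"
    using cos_minus[of "(t - a) + (t - b)"] by (simp add: algebra_simps)
  moreover have "cos (b - a) = cos ((t - a) - (t - b))" by simp
  ultimately show ?thesis by (simp only: inner_circ cos_add cos_diff)
qed

lemma closed_segment_edge_of_convex_hull:
  fixes a b :: "'a::euclidean_space"
  assumes "finite S" "a \<in> S" "b \<in> S" "a \<noteq> b" "w \<bullet> a = c" "w \<bullet> b = c"
    and below: "\<And>v. v \<in> S - {a, b} \<Longrightarrow> w \<bullet> v < c"
  shows "closed_segment a b edge_of convex hull S"
proof -
  have "affine hull {a, b} \<subseteq> {x. w \<bullet> x = c}"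
    using assms(5,6) by (intro hull_minimal) (auto simp: affine_hyperplane)
  moreover have "convex hull (S - {a, b}) \<subseteq> {x. w \<bullet> x < c}"
    using below by (intro hull_minimal) (auto simp: convex_halfspace_lt)
  ultimately have "convex hull {a, b} face_of convex hull S"
    using assms(1-3) by (intro face_of_convex_hulls) fastforce+
  then show ?thesis
    using assms(4) by (simp add: edge_of_def segment_convex_hull aff_dim_convex_hull)
qed

text \<open>In the plane the line through two points of an edge is the affine hull of the edge, so it meets
  \<open>P\<close> in the edge only. A segment joining points of \<open>P\<close> on either side of the line crosses it at
  a point of the edge, and then the face property puts both ends of the segment on the edge.\<close>
lemma edge_not_separating:
  fixes P :: "(real^2) set"
  assumes "convex P" "e edge_of P" "a \<in> e" "b \<in> e" "a \<noteq> b" "w \<bullet> a = c" "w \<bullet> b = c" "w \<noteq> 0"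
    and uv: "u \<in> P" "v \<in> P" "w \<bullet> u < c" "c < w \<bullet> v"
  shows False
proof -
  let ?L = "{x. w \<bullet> x = c}"
  have face: "e face_of P" and dim: "aff_dim e = 1" using assms(2) by (auto simp: edge_of_def)
  have ab: "affine hull {a, b} = affine hull e"
  proof (rule affine_dim_equal)
    show "affine hull {a, b} \<subseteq> affine hull e" using assms(3,4) by (intro hull_mono) auto
  qed (use assms(5) dim in auto)
  have "affine hull {a, b} = ?L"
  proof (rule affine_dim_equal)
    show "affine hull {a, b} \<subseteq> ?L"
      using assms(6,7) by (intro hull_minimal) (auto simp: affine_hyperplane)
    show "aff_dim (affine hull {a, b}) = aff_dim ?L"
      using assms(5,8) by (simp add: aff_dim_hyperplane)
  qed (auto simp: affine_hyperplane)
  with ab have "e = ?L \<inter> P"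
    using face_of_imp_eq_affine_Int[OF assms(1) face] by simp
  define s where "s = (c - w \<bullet> u) / (w \<bullet> v - w \<bullet> u)"
  define z where "z = (1 - s) *\<^sub>R u + s *\<^sub>R v"
  have s: "0 < s" "s < 1" using uv(3,4) by (auto simp: s_def field_simps)
  have "w \<bullet> z = w \<bullet> u + s * (w \<bullet> v - w \<bullet> u)"
    by (simp add: z_def inner_add_right algebra_simps)
  also have "\<dots> = c" using uv(3,4) by (simp add: s_def)
  finally have "w \<bullet> z = c" .
  moreover have "z \<in> P" unfolding z_def using s uv(1,2) by (intro convexD_alt[OF assms(1)]) auto
  ultimately have "z \<in> e" using \<open>e = ?L \<inter> P\<close> by simp
  moreover have "z \<in> open_segment u v"
    using s uv(3,4) by (auto simp: in_segment z_def)
  ultimately have "u \<in> e" using face uv(1,2) by (auto simp: face_of_def)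
  then show False using \<open>e = ?L \<inter> P\<close> uv(3) by simp
qed

text \<open>Vertices sit at the angles \<open>2 * \<theta> i\<close>, so that the half-angles \<open>\<theta> i\<close> stay in a half-open
  interval of length \<open>pi\<close> and \<open>sin (\<theta> l - \<theta> i)\<close> has the sign of \<open>l - i\<close>. By \<open>circ_chord_side\<close>, the line
  through \<open>V i\<close> and \<open>V j\<close> then separates the vertices with index between \<open>i\<close> and \<open>j\<close> from
  those with index outside. For cyclically consecutive \<open>i, j\<close> one of these groups is empty and the chord is
  an edge; otherwise both are nonempty and it is not.\<close>
lemma edges_of_cyclic_polygon:
  fixes \<theta> :: "nat \<Rightarrow> real" and k :: nat
  assumes k: "3 \<le> k" and r: "0 < r"
    and mono: "\<And>i j. i < j \<Longrightarrow> j < k \<Longrightarrow> \<theta> i < \<theta> j"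
    and range: "\<And>i. i < k \<Longrightarrow> 0 \<le> \<theta> i \<and> \<theta> i < pi"
  defines "V \<equiv> \<lambda>i. r *\<^sub>R circ (2 * \<theta> i)"
  shows "bij_betw (\<lambda>i. closed_segment (V i) (V (Suc i mod k))) {..<k}
           {e. e edge_of convex hull (V ` {..<k})}"
    and "polytope (convex hull (V ` {..<k}))"
    and "interior (convex hull (V ` {..<k})) \<noteq> {}"
proof -
  let ?S = "V ` {..<k}"
  let ?P = "convex hull ?S"
  let ?e = "\<lambda>i. closed_segment (V i) (V (Suc i mod k))"
  show poly: "polytope ?P" by (simp add: polytope_convex_hull)
  define w where "w i j = circ (\<theta> i + \<theta> j)" for i j
  define c where "c i j = r * cos (\<theta> j - \<theta> i)" for i j
  have side: "w i j \<bullet> V l - c i j = - 2 * r * (sin (\<theta> l - \<theta> i) * sin (\<theta> l - \<theta> j))" for i j l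
    using circ_chord_side[of "\<theta> i" "\<theta> j" "\<theta> l"] 
    by (simp add: w_def c_def V_def flip: right_diff_distrib)
  have sin_pos: "0 < sin (\<theta> l - \<theta> i)" if "i < l" "l < k" for i l
    using mono[OF that] range[of i] range[of l] that by (intro sin_gt_zero) auto
  have sin_neg: "sin (\<theta> l - \<theta> i) < 0" if "l < i" "i < k" for i l
    using sin_pos[OF that] sin_minus[of "\<theta> i - \<theta> l"] by simp
  have on: "w i j \<bullet> V i = c i j" "w i j \<bullet> V j = c i j" for i j
    using side[of i j i] side[of i j j] by auto
  have inside: "c i j < w i j \<bullet> V l" if "i < l" "l < j" "j < k" for i j l
  proof -
    have "sin (\<theta> l - \<theta> i) * sin (\<theta> l - \<theta> j) < 0"
      using sin_pos[of i l] sin_neg[of l j] that by (simp add: mult_pos_neg)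
    then have "0 < w i j \<bullet> V l - c i j" unfolding side using r by (simp add: mult_pos_neg)
    then show ?thesis by simp
  qed
  have outside: "w i j \<bullet> V l < c i j" if "l < i \<or> j < l" "i < j" "j < k" "l < k" for i j l
  proof -
    have "0 < sin (\<theta> l - \<theta> i) * sin (\<theta> l - \<theta> j)"
      using that(1)
    proof
      assume "l < i"
      then show ?thesis using sin_neg[of l i] sin_neg[of l j] that by (simp add: mult_neg_neg)
    next
      assume "j < l"
      then show ?thesis using sin_pos[of i l] sin_pos[of j l] that by simp
    qed
    then have "w i j \<bullet> V l - c i j < 0" unfolding side using r by simp
    then show ?thesis by simp
  qed
  have V_ne: "V i \<noteq> V j" if "i < j" "j < k" for i j
  proof -
    have "dist (circ (2 * \<theta> j)) (circ (2 * \<theta> i)) > 0"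
      using sin_pos[OF that] by (simp add: dist_circ)
    then show ?thesis using r by (auto simp: V_def)
  qed
  then have inj: "inj_on V {..<k}"
    unfolding inj_on_def by (metis lessThan_iff linorder_neqE_nat)
  have w0: "w i j \<noteq> 0" for i j
  proof -
    have "w i j \<bullet> w i j = 1" by (simp add: w_def inner_circ)
    then show ?thesis by force
  qed
  have next_cases: "(Suc i < k \<and> Suc i mod k = Suc i) \<or> (i = k - 1 \<and> Suc i mod k = 0)" if "i < k" for i
    using that by (cases "Suc i = k") auto
  have edge: "?e i edge_of ?P" if "i < k" for i
    using next_cases[OF that]
  proof
    assume i: "Suc i < k \<and> Suc i mod k = Suc i"
    have below: "w i (Suc i) \<bullet> v < c i (Suc i)" if "v \<in> ?S - {V i, V (Suc i)}" for v
    proof -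
      obtain l where "v = V l" "l < k" "l < i \<or> Suc i < l"
        using \<open>v \<in> _\<close> by (auto simp: neq_iff less_Suc_eq not_less_eq)
          (metis linorder_neqE_nat not_less_eq)
      then show ?thesis using outside[of l i "Suc i"] i by auto
    qed
    have "closed_segment (V i) (V (Suc i)) edge_of ?P"
      using i V_ne[of i "Suc i"] on[of i "Suc i"]
      by (intro closed_segment_edge_of_convex_hull[OF _ _ _ _ _ _ below]) auto
    then show ?thesis using i by simp
  next
    assume i: "i = k - 1 \<and> Suc i mod k = 0"
    have below: "- w 0 i \<bullet> v < - c 0 i" if "v \<in> ?S - {V i, V 0}" for v
    proof -
      obtain l where "v = V l" "0 < l" "l < i"
        using \<open>v \<in> _\<close> i by auto (metis Suc_pred bot_nat_0.not_eq_extremum less_Suc_eq less_nat_zero_code)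
      then show ?thesis using inside[of 0 l i] i k by auto
    qed
    have "closed_segment (V i) (V 0) edge_of ?P"
      using i k V_ne[of 0 i] on[of 0 i]
      by (intro closed_segment_edge_of_convex_hull[OF _ _ _ _ _ _ below]) auto
    then show ?thesis using i by metis
  qed
  have edge_adjacent: "\<exists>i<k. e = ?e i" if e: "e edge_of ?P" for e
  proof -
    obtain a b where ab: "e = closed_segment a b" "a \<noteq> b"
      using edge_of_is_segment[OF poly e] .
    have "a extreme_point_of ?P" "b extreme_point_of ?P"
      using e ab extreme_point_of_face[of e ?P] extreme_point_of_segment[of _ a b]
      by (auto simp: edge_of_def)
    then have "a \<in> ?S" "b \<in> ?S" using extreme_point_of_convex_hull by blast+
    then obtain i j where ij: "i < j" "j < k" "e = closed_segment (V i) (V j)"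
      using ab by (metis (no_types, lifting) closed_segment_commute imageE lessThan_iff linorder_neqE_nat)
    have "j = Suc i \<or> (i = 0 \<and> j = k - 1)"
    proof (rule ccontr)
      assume far: "\<not> ?thesis"
      \<comment> \<open>The chord from \<open>i\<close> to \<open>j\<close> has vertex \<open>Suc i\<close> on one side and vertex \<open>l\<close> on the other.\<close>
      define l where "l = (if i = 0 then k - 1 else 0)"
      have "l < i \<or> j < l" "l < k" using far ij(1,2) by (auto simp: l_def)
      then have "w i j \<bullet> V l < c i j" using outside ij by blast
      moreover have "c i j < w i j \<bullet> V (Suc i)" using inside[of i "Suc i" j] far ij by auto
      moreover have "V l \<in> ?P" "V (Suc i) \<in> ?P"
        using \<open>l < k\<close> ij by (auto intro!: hull_inc)
      ultimately show False
        using edge_not_separating[OF convex_convex_hull e, of "V i" "V j" "w i j" "c i j"]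
          ij V_ne[OF ij(1,2)] on[of i j] w0 by auto
    qed
    then show ?thesis
    proof
      assume "j = Suc i"
      then show ?thesis using ij by (intro exI[of _ i]) simp
    next
      assume "i = 0 \<and> j = k - 1"
      then show ?thesis using ij k by (intro exI[of _ j]) (simp add: closed_segment_commute)
    qed
  qed
  have "inj_on ?e {..<k}"
  proof (rule inj_onI)
    fix i j assume i: "i \<in> {..<k}" and j: "j \<in> {..<k}" and "?e i = ?e j"
    then have "{V i, V (Suc i mod k)} = {V j, V (Suc j mod k)}"
      by (simp add: closed_segment_eq)
    then have "V ` {i, Suc i mod k} = V ` {j, Suc j mod k}" by simp
    then have eq: "{i, Suc i mod k} = {j, Suc j mod k}"
      using inj_on_image_eq_iff[OF inj, of "{i, Suc i mod k}" "{j, Suc j mod k}"] i j k by simp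
    show "i = j"
    proof (rule ccontr)
      assume "i \<noteq> j"
      with eq have "i = Suc j mod k" "j = Suc i mod k" by (auto simp: doubleton_eq_iff)
      then show False using next_cases[of i] next_cases[of j] i j k by auto
    qed
  qed
  then show bij: "bij_betw ?e {..<k} {e. e edge_of ?P}"
    unfolding bij_betw_def using edge edge_adjacent by blast
  have "?e 0 face_of ?P" "aff_dim (?e 0) = 1" using edge[of 0] k by (auto simp: edge_of_def)
  moreover have "?e 0 \<noteq> ?P"
  proof
    assume "?e 0 = ?P"
    have "?P \<subseteq> {x. w 0 1 \<bullet> x = c 0 1}"
      using on[of 0 1] k unfolding \<open>?e 0 = ?P\<close>[symmetric] segment_convex_hull
      by (intro hull_minimal) (auto simp: convex_hyperplane)
    moreover have "V 2 \<in> ?P" using k by (auto intro!: hull_inc)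
    ultimately show False using outside[of 2 0 1] k by auto
  qed
  ultimately have "1 < aff_dim ?P"
    using face_of_aff_dim_lt[OF convex_convex_hull] by metis
  then have "aff_dim ?P = DIM(real^2)" using aff_dim_le_DIM[of ?P] by simp
  moreover have "V 0 \<in> ?P" using k by (auto intro!: hull_inc)
  then have "?P \<noteq> {}" by blast
  ultimately show "interior ?P \<noteq> {}"
    using rel_interior_eq_empty[OF convex_convex_hull, of ?S] by (simp add: interior_rel_interior_gen)
qed

lemma forms_polygon_if_short:
  assumes k: "3 \<le> length xs" and pos: "\<forall>x\<in>set xs. 1 \<le> x" and short: "\<forall>x\<in>set xs. 2 * x < sum_list xs"
  shows "forms_polygon xs"
proof -
  let ?k = "length xs"
  let ?x = "\<lambda>i. real (xs ! i)"
  have "Max (set xs) \<in> set xs" using k by (intro Max_in) auto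
  then obtain m where m: "m < ?k" "xs ! m = Max (set xs)" by (metis in_set_conv_nth)
  have max: "xs ! i \<le> xs ! m" if "i < ?k" for i using that m by simp
  have "2 * ?x m < (\<Sum>i<?k. ?x i)"
  proof -
    have "2 * xs ! m < sum_list xs" using short m(1) by simp
    then have "real (2 * xs ! m) < real (sum_list xs)" by linarith
    then show ?thesis by (simp add: sum_list_sum_nth atLeast0LessThan)
  qed
  then have "?x m < (\<Sum>i\<in>{..<?k} - {m}. ?x i)"
    using m(1) by (simp add: sum.remove[of "{..<?k}" m])
  then obtain s \<alpha> where s: "0 < s" and \<alpha>: "\<And>i. i < ?k \<Longrightarrow> 0 < \<alpha> i"
    and x: "\<And>i. i < ?k \<Longrightarrow> ?x i = s * sin (\<alpha> i)" and sum: "(\<Sum>i<?k. \<alpha> i) = pi"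
    using exists_half_angles[of "{..<?k}" ?x m] pos m max by (auto simp: Suc_le_eq)
  define \<theta> where "\<theta> i = (\<Sum>j<i. \<alpha> j)" for i
  have mono: "\<theta> i < \<theta> j" if "i < j" "j \<le> ?k" for i j
    unfolding \<theta>_def using that \<alpha>
    by (intro sum_strict_mono2[where b = i]) (auto intro: less_imp_le)
  have range: "0 \<le> \<theta> i \<and> \<theta> i < pi" if "i < ?k" for i
    using mono[OF that] sum \<alpha> that by (auto simp: \<theta>_def intro!: sum_nonneg less_imp_le[OF \<alpha>])
  define V where "V i = (s / 2) *\<^sub>R circ (2 * \<theta> i)" for i
  let ?P = "convex hull (V ` {..<?k})"
  let ?e = "\<lambda>i. closed_segment (V i) (V (Suc i mod ?k))"
  note polygon = edges_of_cyclic_polygon[OF k, of "s / 2" \<theta>, folded V_def]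
  have bij: "bij_betw ?e {..<?k} {e. e edge_of ?P}"
    and poly: "polytope ?P" "interior ?P \<noteq> {}"
    using polygon mono range s by auto
  have length: "diameter (?e i) = ?x i" if i: "i < ?k" for i
  proof -
    have "diameter (?e i) = s / 2 * dist (circ (2 * \<theta> i)) (circ (2 * \<theta> (Suc i mod ?k)))"
      using s by (simp add: diameter_closed_segment V_def dist_norm flip: scaleR_diff_right)
    also have "\<dots> = s * \<bar>sin (\<theta> i - \<theta> (Suc i mod ?k))\<bar>"
      by (simp add: dist_circ)
    also have "\<bar>sin (\<theta> i - \<theta> (Suc i mod ?k))\<bar> = \<bar>sin (\<alpha> i)\<bar>"
    proof (cases "Suc i = ?k")
      case True
      \<comment> \<open>The closing chord subtends the half-angle \<open>pi - \<alpha> i\<close>, which has the same sine as \<open>\<alpha> i\<close>.\<close>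
      have "\<theta> i = pi - \<alpha> i" using sum by (simp add: \<theta>_def flip: True)
      then show ?thesis using True by (simp add: \<theta>_def)
    next
      case False
      then show ?thesis using i by (simp add: \<theta>_def)
    qed
    also have "s * \<dots> = ?x i"
      using x[OF i] s by (metis abs_mult abs_of_nat abs_of_pos)
    finally show ?thesis .
  qed
  have "card {e. e edge_of ?P} = ?k" using bij_betw_same_card[OF bij] by simp
  then have "convex_polygon ?k ?P" using poly by (simp add: convex_polygon_def)
  moreover have "side_lengths ?P = mset (map real xs)"
  proof -
    have "side_lengths ?P = image_mset diameter (image_mset ?e (mset_set {..<?k}))"
      using bij by (simp add: side_lengths_def image_mset_mset_set bij_betw_def)
    also have "\<dots> = image_mset ?x (mset_set {..<?k})"
      by (simp add: multiset.map_comp) (rule image_mset_cong, simp add: length)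
    also have "\<dots> = mset (map ?x [0..<?k])"
      by (simp add: atLeast0LessThan)
    also have "map ?x [0..<?k] = map real xs" by (auto intro: nth_equalityI)
    finally show ?thesis .
  qed
  ultimately show ?thesis by (auto simp: forms_polygon_def)
qed

section \<open>Counting compositions with no long part\<close>

text \<open>Cut points are determined by their successive differences. The start \<open>p\<close> is arbitrary for the
  sake of the induction; \<open>pieces\<close> is the case \<open>p = 0\<close>.\<close>
lemma map2_diff_inject:
  fixes as bs :: "nat list"
  assumes "sorted (p # as)" "sorted (p # bs)" "length as = length bs"
    and "map2 (\<lambda>a b. b - a) (p # as) (as @ [n]) = map2 (\<lambda>a b. b - a) (p # bs) (bs @ [n])"
  shows "as = bs"
  using assms(3,1,2,4)
proof (induction as bs arbitrary: p rule: list_induct2)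
  case (Cons a as b bs)
  then have "a - p = b - p" "p \<le> a" "p \<le> b" by auto
  then have "a = b" by linarith
  with Cons show ?case by auto
qed simp

lemma map2_diff_composition:
  fixes as :: "nat list"
  assumes "sorted_wrt (<) (p # as @ [n])"
  shows "(\<forall>x\<in>set (map2 (\<lambda>a b. b - a) (p # as) (as @ [n])). 1 \<le> x) \<and>
         sum_list (map2 (\<lambda>a b. b - a) (p # as) (as @ [n])) = n - p"
  using assms
proof (induction as arbitrary: p)
  case (Cons a as)
  then have "p < a" "a < n" "sorted_wrt (<) (a # as @ [n])" by auto
  with Cons.IH[of a] show ?case by auto
qed auto

definition compositions :: "nat \<Rightarrow> nat \<Rightarrow> nat list set" where
  "compositions n k = {xs. length xs = k \<and> (\<forall>x\<in>set xs. 1 \<le> x) \<and> sum_list xs = n}"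

lemma sum_list_map2_add:
  fixes xs ys :: "nat list"
  assumes "length xs = length ys"
  shows "sum_list (map2 (+) xs ys) = sum_list xs + sum_list ys"
  using assms by (induction xs ys rule: list_induct2) auto

lemma sum_list_mono_list_all2:
  fixes xs ys :: "nat list"
  assumes "list_all2 (\<le>) xs ys"
  shows "sum_list xs \<le> sum_list ys"
  using assms by induction auto

text \<open>Subtracting the lower bounds leaves an arbitrary list of naturals of given length and sum.\<close>
lemma card_lists_with_lower_bounds:
  fixes los :: "nat list"
  assumes "los \<noteq> []"
  shows "card {xs. list_all2 (\<le>) los xs \<and> sum_list xs = n} =
         (if sum_list los \<le> n then (n - sum_list los + (length los - 1)) choose (length los - 1)
          else 0)"
proof (cases "sum_list los \<le> n")
  case True
  let ?N = "n - sum_list los"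
  let ?Y = "{ys. length ys = length los \<and> sum_list ys = ?N}"
  have "bij_betw (map2 (+) los) ?Y {xs. list_all2 (\<le>) los xs \<and> sum_list xs = n}"
  proof (rule bij_betw_byWitness[where f' = "\<lambda>xs. map2 (-) xs los"])
    show "\<forall>ys\<in>?Y. map2 (-) (map2 (+) los ys) los = ys"
      by (auto intro!: nth_equalityI)
    show "\<forall>xs\<in>{xs. list_all2 (\<le>) los xs \<and> sum_list xs = n}. map2 (+) los (map2 (-) xs los) = xs"
      by (auto intro!: nth_equalityI simp: list_all2_conv_all_nth)
    show "map2 (+) los ` ?Y \<subseteq> {xs. list_all2 (\<le>) los xs \<and> sum_list xs = n}"
      using True by (auto simp: list_all2_conv_all_nth sum_list_map2_add)
    show "(\<lambda>xs. map2 (-) xs los) ` {xs. list_all2 (\<le>) los xs \<and> sum_list xs = n} \<subseteq> ?Y"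
    proof (rule image_subsetI)
      fix xs assume "xs \<in> {xs. list_all2 (\<le>) los xs \<and> sum_list xs = n}"
      then have xs: "list_all2 (\<le>) los xs" and sum: "sum_list xs = n" by auto
      have len: "length xs = length los" using xs by (simp add: list_all2_lengthD)
      have "map2 (+) los (map2 (-) xs los) = xs"
        using xs by (auto intro!: nth_equalityI simp: list_all2_conv_all_nth)
      then have "sum_list los + sum_list (map2 (-) xs los) = sum_list xs"
        using sum_list_map2_add[of los "map2 (-) xs los"] len by simp
      then show "map2 (-) xs los \<in> ?Y"
        using len sum by simp
    qed
  qed
  then have "card {xs. list_all2 (\<le>) los xs \<and> sum_list xs = n} = card ?Y"
    by (simp add: bij_betw_same_card)
  also have "\<dots> = (?N + length los - 1) choose ?N"
    by (rule card_length_sum_list)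
  also have "\<dots> = (?N + (length los - 1)) choose (length los - 1)"
    using assms binomial_symmetric[of ?N "?N + (length los - 1)"]
    by (cases los) simp_all
  finally show ?thesis using True by simp
next
  case False
  then have "{xs. list_all2 (\<le>) los xs \<and> sum_list xs = n} = {}"
    using sum_list_mono_list_all2 by fastforce
  with False show ?thesis by (simp del: Collect_empty_eq)
qed

lemma card_compositions:
  assumes "1 \<le> k" "k \<le> n"
  shows "card (compositions n k) = (n - 1) choose (k - 1)"
proof -
  have "compositions n k = {xs. list_all2 (\<le>) (replicate k 1) xs \<and> sum_list xs = n}"
    unfolding compositions_def list_all2_conv_all_nth by (auto simp: all_set_conv_all_nth)
  moreover have "n - k + (k - 1) = n - 1" using assms by simp
  ultimately show ?thesis
    using card_lists_with_lower_bounds[of "replicate k 1" n] assms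
    by (simp add: sum_list_replicate)
qed

lemma card_compositions_long_part:
  assumes "2 \<le> k" "k \<le> n" "i < k"
  shows "card {xs \<in> compositions n k. n \<le> 2 * xs ! i} = (n div 2) choose (k - 1)"
proof -
  \<comment> \<open>The ceiling of \<open>n / 2\<close>, the least size of a part that is too long.\<close>
  let ?c = "n - n div 2"
  let ?los = "(replicate k 1)[i := ?c]"
  have half: "n \<le> 2 * x \<longleftrightarrow> ?c \<le> x" for x by linarith
  have c1: "1 \<le> ?c" using assms by linarith
  have "{xs \<in> compositions n k. n \<le> 2 * xs ! i} =
        {xs. list_all2 (\<le>) ?los xs \<and> sum_list xs = n}" (is "?L = ?R")
  proof (rule set_eqI)
    fix xs
    have "(\<forall>x\<in>set xs. 1 \<le> x) \<and> n \<le> 2 * xs ! i \<longleftrightarrow> (\<forall>j<k. ?los ! j \<le> xs ! j)"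
      if "length xs = k"
    proof -
      have "(\<forall>j<k. ?los ! j \<le> xs ! j) \<longleftrightarrow> (\<forall>j<k. 1 \<le> xs ! j) \<and> ?c \<le> xs ! i"
        using assms(3) c1 by (auto simp: nth_list_update intro: order_trans split: if_splits)
      then show ?thesis by (simp only: all_set_conv_all_nth that half)
    qed
    then show "xs \<in> ?L \<longleftrightarrow> xs \<in> ?R"
      by (auto simp: compositions_def list_all2_conv_all_nth)
  qed
  moreover have "sum_list ?los = k - 1 + ?c"
    using assms(3) by (simp add: sum_list_update sum_list_replicate)
  ultimately have "card {xs \<in> compositions n k. n \<le> 2 * xs ! i} =
      (if k - 1 + ?c \<le> n then (n - (k - 1 + ?c) + (k - 1)) choose (k - 1) else 0)"
    using card_lists_with_lower_bounds[of ?los n] assms by simp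
  also have "\<dots> = (n div 2) choose (k - 1)"
  proof (cases "k - 1 \<le> n div 2")
    case True
    then have "k - 1 + ?c \<le> n" "n - (k - 1 + ?c) + (k - 1) = n div 2" by linarith+
    then show ?thesis by simp
  next
    case False
    then have "\<not> k - 1 + ?c \<le> n" by linarith
    with False show ?thesis by (simp add: binomial_eq_0)
  qed
  finally show ?thesis .
qed

lemma finite_compositions: "finite (compositions n k)"
proof (rule finite_subset)
  show "compositions n k \<subseteq> {xs. set xs \<subseteq> {..n} \<and> length xs = k}"
    by (auto simp: compositions_def dest: member_le_sum_list)
qed (simp add: finite_lists_length_eq)

text \<open>Two parts of size at least \<open>n / 2\<close> would leave nothing for a third part.\<close>
lemma composition_unique_long_part:
  assumes "3 \<le> k" "xs \<in> compositions n k" "i < k" "j < k" "n \<le> 2 * xs ! i" "n \<le> 2 * xs ! j"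
  shows "i = j"
proof (rule ccontr)
  assume "i \<noteq> j"
  have len: "length xs = k" and pos: "\<And>l. l < k \<Longrightarrow> 1 \<le> xs ! l" and sum: "sum_list xs = n"
    using assms(2) by (auto simp: compositions_def)
  have "card {i, j} < card {..<k}" using assms(1) card_insert_le_m1[of 2 "{j}" i] by (simp add: \<open>i \<noteq> j\<close>)
  then have "\<not> {..<k} \<subseteq> {i, j}" using card_mono[of "{i, j}" "{..<k}"] by auto
  then obtain l where l: "l < k" "l \<noteq> i" "l \<noteq> j" by auto
  have "(\<Sum>m\<in>{i, j, l}. xs ! m) \<le> (\<Sum>m<k. xs ! m)"
    using assms(3,4) l by (intro sum_mono2) auto
  also have "\<dots> = n" using sum len by (simp add: sum_list_sum_nth atLeast0LessThan)
  finally have "xs ! i + xs ! j + xs ! l \<le> n"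
    using \<open>i \<noteq> j\<close> l by simp
  then show False using pos[OF l(1)] assms(5,6) by linarith
qed

text \<open>Stated additively, to avoid truncated subtraction.\<close>
lemma card_compositions_all_parts_short:
  assumes "3 \<le> k" "k \<le> n"
  shows "card {xs \<in> compositions n k. \<forall>x\<in>set xs. 2 * x < n} + k * ((n div 2) choose (k - 1)) =
         (n - 1) choose (k - 1)"
proof -
  let ?good = "{xs \<in> compositions n k. \<forall>x\<in>set xs. 2 * x < n}"
  let ?B = "\<lambda>i. {xs \<in> compositions n k. n \<le> 2 * xs ! i}"
  have fin: "finite (?B i)" for i by (simp add: finite_compositions)
  have "compositions n k = ?good \<union> (\<Union>i<k. ?B i)"
    by (auto simp: compositions_def all_set_conv_all_nth not_less)
  moreover have "?good \<inter> (\<Union>i<k. ?B i) = {}"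
    by (fastforce simp: compositions_def all_set_conv_all_nth)
  moreover have "card (\<Union>i<k. ?B i) = (\<Sum>i<k. card (?B i))"
  proof (rule card_UN_disjoint)
    show "\<forall>i\<in>{..<k}. \<forall>j\<in>{..<k}. i \<noteq> j \<longrightarrow> ?B i \<inter> ?B j = {}"
      using composition_unique_long_part[OF assms(1)] by blast
  qed (auto simp: fin)
  moreover have "(\<Sum>i<k. card (?B i)) = k * ((n div 2) choose (k - 1))"
    using card_compositions_long_part assms by simp
  ultimately have "card (compositions n k) = card ?good + k * ((n div 2) choose (k - 1))"
    using card_Un_disjoint[of ?good "\<Union>i<k. ?B i"] fin by (simp add: finite_compositions)
  then show ?thesis using card_compositions assms by simp
qed

text \<open>Both sets have \<open>(n - 1) choose (k - 1)\<close> elements, so an injective map between them is onto.\<close>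
lemma bij_betw_pieces:
  assumes "1 \<le> k" "k \<le> n"
  shows "bij_betw (pieces n) {A. A \<subseteq> {1..n - 1} \<and> card A = k - 1} (compositions n k)"
    (is "bij_betw _ ?A _")
proof -
  have fin: "finite A" if "A \<in> ?A" for A using that finite_subset by auto
  have inj: "inj_on (pieces n) ?A"
  proof (rule inj_onI)
    fix A B assume A: "A \<in> ?A" and B: "B \<in> ?A" and eq: "pieces n A = pieces n B"
    have "sorted_list_of_set A = sorted_list_of_set B"
    proof (rule map2_diff_inject[of 0 _ _ n])
      show "length (sorted_list_of_set A) = length (sorted_list_of_set B)" using A B by simp
    qed (use eq in \<open>simp_all only: pieces_def Let_def sorted_simps sorted_sorted_list_of_set, simp_all\<close>)
    then show "A = B" using fin A B by (metis set_sorted_list_of_set)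
  qed
  have sub: "pieces n ` ?A \<subseteq> compositions n k"
  proof clarify
    fix A assume A: "A \<subseteq> {1..n - 1}" "card A = k - 1"
    then have fA: "finite A" using finite_subset by auto
    have "sorted_wrt (<) (0 # sorted_list_of_set A @ [n])"
      using A fA assms by (fastforce simp: sorted_wrt_append)
    from map2_diff_composition[OF this] show "pieces n A \<in> compositions n k"
      using A assms fA by (simp add: compositions_def pieces_def Let_def)
  qed
  have "card ?A = (n - 1) choose (k - 1)"
    using n_subsets[of "{1..n - 1}" "k - 1"] by simp
  then have "card (pieces n ` ?A) = card (compositions n k)"
    unfolding card_image[OF inj] card_compositions[OF assms] .
  then have "pieces n ` ?A = compositions n k"
    by (rule card_subset_eq[OF finite_compositions sub])
  with inj show ?thesis by (simp add: bij_betw_def)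
qed

section \<open>The probability of a polygon\<close>

theorem theorem3:
  fixes n k :: nat
  assumes "3 \<le> k" and "k \<le> n"
  shows "measure_pmf.prob (pmf_of_set {A. A \<subseteq> {1..n - 1} \<and> card A = k - 1})
           {A. forms_polygon (pieces n A)} =
         1 - real k * real ((n div 2) choose (k - 1)) / real ((n - 1) choose (k - 1))"
proof -
  let ?A = "{A. A \<subseteq> {1..n - 1} \<and> card A = k - 1}"
  let ?good = "{xs \<in> compositions n k. \<forall>x\<in>set xs. 2 * x < n}"
  have cardA: "card ?A = (n - 1) choose (k - 1)"
    using n_subsets[of "{1..n - 1}" "k - 1"] by simp
  have pos: "0 < (n - 1) choose (k - 1)" using assms by (simp add: zero_less_binomial)
  have finA: "finite ?A" and neA: "?A \<noteq> {}"
    using cardA pos by (metis card.infinite less_irrefl, metis card.empty less_irrefl)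
  have iff: "forms_polygon xs \<longleftrightarrow> (\<forall>x\<in>set xs. 2 * x < n)" if "xs \<in> compositions n k" for xs
    using that assms(1) forms_polygon_if_short[of xs] forms_polygon_imp_short[of xs]
    by (auto simp: compositions_def)
  have bij: "bij_betw (pieces n) ?A (compositions n k)"
    using bij_betw_pieces assms by simp
  have img: "pieces n ` (?A \<inter> {A. forms_polygon (pieces n A)}) = ?good"
  proof (intro subset_antisym subsetI)
    fix xs assume "xs \<in> ?good"
    then have xs: "xs \<in> compositions n k" "forms_polygon xs" using iff by auto
    then obtain A where "A \<in> ?A" "xs = pieces n A" using bij_betw_imp_surj_on[OF bij] by blast
    then show "xs \<in> pieces n ` (?A \<inter> {A. forms_polygon (pieces n A)})" using xs by blast
  next
    fix xs assume "xs \<in> pieces n ` (?A \<inter> {A. forms_polygon (pieces n A)})"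
    then have "xs \<in> compositions n k" "forms_polygon xs"
      using bij_betw_imp_surj_on[OF bij] by blast+
    then show "xs \<in> ?good" using iff by simp
  qed
  have inj: "inj_on (pieces n) (?A \<inter> {A. forms_polygon (pieces n A)})"
    using bij by (auto simp: bij_betw_def intro: inj_on_subset)
  have "card (?A \<inter> {A. forms_polygon (pieces n A)}) = card ?good"
    unfolding img[symmetric] by (rule card_image[OF inj, symmetric])
  moreover have "real (card ?good) = real ((n - 1) choose (k - 1)) - real k * real ((n div 2) choose (k - 1))"
    using arg_cong[OF card_compositions_all_parts_short[OF assms], of real] by simp
  ultimately show ?thesis
    unfolding measure_pmf_of_set[OF neA finA] cardA using pos by (simp only: diff_divide_distrib) simp
qed

end
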